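(* For every integer $k\geq 1$ there exists a balanced edge-coloring of the complete graph $K_{13^k}$ with $6$ colors that contains no rainbow copy of $K_4$.
   Context: An edge-coloring of the complete graph $K_n$ is called balanced if every vertex is incident to the same number of edges of each color. A copy of a graph $H$ in an edge-colored $K_n$ is rainbow if all of its edges receive pairwise different colors; thus a rainbow $K_4$ is a set of four vertices whose six connecting edges all have distinct colors. *)

theory Defs
  imports "HOL-Library.Ramsey"
begin

text \<open>The edge set of the complete graph on a vertex set \<open>V\<close> is \<open>[V]\<^bsup>2\<^esup>\<close>, the
  set of two-element subsets of \<open>V\<close>.\<close>

definition edge_coloring :: "'v set \<Rightarrow> 'c set \<Rightarrow> ('v set \<Rightarrow> 'c) \<Rightarrow> bool" where
  "edge_coloring V C f \<longleftrightarrow> f \<in> [V]\<^bsup>2\<^esup> \<rightarrow> C"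

definition color_degree :: "'v set \<Rightarrow> ('v set \<Rightarrow> 'c) \<Rightarrow> 'v \<Rightarrow> 'c \<Rightarrow> nat" where
  "color_degree V f v c = card {e \<in> [V]\<^bsup>2\<^esup>. v \<in> e \<and> f e = c}"

text \<open>The number \<open>d\<close> depends neither on the color nor on the vertex; a color of \<open>C\<close>
  that is not used counts with degree \<open>0\<close>.\<close>

definition balanced :: "'v set \<Rightarrow> 'c set \<Rightarrow> ('v set \<Rightarrow> 'c) \<Rightarrow> bool" where
  "balanced V C f \<longleftrightarrow> (\<exists>d. \<forall>v\<in>V. \<forall>c\<in>C. color_degree V f v c = d)"

text \<open>A copy of the complete graph on \<open>m\<close> vertices inside a complete graph is determined
  by its vertex set.\<close>

definition has_rainbow_complete :: "nat \<Rightarrow> 'v set \<Rightarrow> ('v set \<Rightarrow> 'c) \<Rightarrow> bool" where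
  "has_rainbow_complete m V f \<longleftrightarrow> (\<exists>S \<in> [V]\<^bsup>m\<^esup>. inj_on f ([S]\<^bsup>2\<^esup>))"

end

theory Submission
  imports Defs
begin

text \<open>Balanced colorings without a rainbow \<open>K\<^sub>m\<close> are closed under lexicographic products:
  join two vertices of different blocks by the color that the outer coloring gives to the blocks,
  and color the inside of every block with the inner coloring. A clique that meets at least two
  blocks, and one of them twice, repeats a color, since two vertices of the same block are joined
  to a third vertex outside of it by edges of equal color; every other clique is a copy of a clique
  in one of the factors. So one suitable coloring of \<open>K\<^bsub>13\<^esub>\<close> suffices. The coloring of \<open>K\<^bsub>13\<^esub>\<close> by
  \<open>\<plusminus>(x - y)\<close> modulo \<open>13\<close> is not suitable, because of the perfect difference set \<open>{0, 1, 3, 9}\<close>.\<close>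

lemma color_degree_eq_card_neighbours:
  assumes "v \<in> V"
  shows "color_degree V f v c = card {w \<in> V. w \<noteq> v \<and> f {v, w} = c}"
proof -
  have "bij_betw (\<lambda>w. {v, w}) {w \<in> V. w \<noteq> v \<and> f {v, w} = c}
          {e \<in> [V]\<^bsup>2\<^esup>. v \<in> e \<and> f e = c}"
    unfolding bij_betw_def
  proof
    show "inj_on (\<lambda>w. {v, w}) {w \<in> V. w \<noteq> v \<and> f {v, w} = c}"
      by (auto simp: inj_on_def doubleton_eq_iff)
    show "(\<lambda>w. {v, w}) ` {w \<in> V. w \<noteq> v \<and> f {v, w} = c} = {e \<in> [V]\<^bsup>2\<^esup>. v \<in> e \<and> f e = c}"
      using assms by (auto simp: nsets_2_eq insert_commute image_iff doubleton_eq_iff)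
  qed
  then show ?thesis
    unfolding color_degree_def by (simp add: bij_betw_same_card)
qed

section \<open>Lexicographic products of colorings\<close>

text \<open>The number \<open>x\<close> stands for the pair of its block \<open>x div n\<close> and
  its position \<open>x mod n\<close>, so that iterated products stay on initial segments of
  \<open>nat\<close>. An edge runs between different blocks iff its image under \<open>div\<close>
  still has two elements.\<close>

definition lex_product ::
    "nat \<Rightarrow> (nat set \<Rightarrow> 'c) \<Rightarrow> (nat set \<Rightarrow> 'c) \<Rightarrow> nat set \<Rightarrow> 'c" where
  "lex_product n f g e =
     (if card ((\<lambda>x. x div n) ` e) = 2 then f ((\<lambda>x. x div n) ` e) else g ((\<lambda>x. x mod n) ` e))"

lemma lex_product_pair:
  "lex_product n f g {x, y} =
     (if x div n = y div n then g {x mod n, y mod n} else f {x div n, y div n})"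
  by (simp add: lex_product_def)

lemma div_mod_lessThan_mult:
  fixes x m n :: nat
  assumes "x < m * n"
  shows "x div n < m" "x mod n < n"
  using assms by (auto simp: less_mult_imp_div_less intro!: mod_less_divisor Nat.gr0I)

lemma mod_neq_if_div_eq:
  fixes x y n :: nat
  shows "x \<noteq> y \<Longrightarrow> x div n = y div n \<Longrightarrow> x mod n \<noteq> y mod n"
  by (metis div_mult_mod_eq)

lemma edge_coloring_lex_product:
  assumes "edge_coloring {..<m} C f" "edge_coloring {..<n} C g"
  shows "edge_coloring {..<m * n} C (lex_product n f g)"
  unfolding edge_coloring_def
proof
  fix e :: "nat set" assume "e \<in> [{..<m * n}]\<^bsup>2\<^esup>"
  then obtain x y where e: "e = {x, y}" and "x \<noteq> y" and lt: "x < m * n" "y < m * n"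
    by (auto simp: nsets_2_eq)
  show "lex_product n f g e \<in> C"
  proof (cases "x div n = y div n")
    case True
    then have "{x mod n, y mod n} \<in> [{..<n}]\<^bsup>2\<^esup>"
      using mod_neq_if_div_eq[OF \<open>x \<noteq> y\<close>] lt[THEN div_mod_lessThan_mult(2)] by simp
    then show ?thesis
      using True assms(2) by (auto simp: e lex_product_pair edge_coloring_def)
  next
    case False
    then have "{x div n, y div n} \<in> [{..<m}]\<^bsup>2\<^esup>"
      using lt[THEN div_mod_lessThan_mult(1)] by simp
    then show ?thesis
      using False assms(1) by (auto simp: e lex_product_pair edge_coloring_def)
  qed
qed

text \<open>A block joined to the block of \<open>v\<close> by color \<open>c\<close> contributes
  all of its \<open>n\<close> vertices; the remaining neighbours lie in the block of
  \<open>v\<close> and are counted by \<open>g\<close>.\<close>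

lemma color_degree_lex_product:
  assumes "v < m * n"
  shows "color_degree {..<m * n} (lex_product n f g) v c =
    color_degree {..<m} f (v div n) c * n + color_degree {..<n} g (v mod n) c"
proof -
  define A where "A = {q \<in> {..<m}. q \<noteq> v div n \<and> f {v div n, q} = c}"
  define B where "B = {r \<in> {..<n}. r \<noteq> v mod n \<and> g {v mod n, r} = c}"
  define N where "N = {w \<in> {..<m * n}. w \<noteq> v \<and> lex_product n f g {v, w} = c}"
  let ?P = "A \<times> {..<n} \<union> {v div n} \<times> B"
  have "bij_betw (\<lambda>w. (w div n, w mod n)) N ?P"
  proof (rule bij_betw_byWitness[where f' = "\<lambda>(q, r). q * n + r"])
    show "\<forall>w\<in>N. (\<lambda>(q, r). q * n + r) (w div n, w mod n) = w"
      by simp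
    show "\<forall>p\<in>?P. (((\<lambda>(q, r). q * n + r) p) div n, ((\<lambda>(q, r). q * n + r) p) mod n) = p"
      by (auto simp: B_def)
    show "(\<lambda>w. (w div n, w mod n)) ` N \<subseteq> ?P"
    proof
      fix p assume "p \<in> (\<lambda>w. (w div n, w mod n)) ` N"
      then obtain w where p: "p = (w div n, w mod n)" and w: "w < m * n" "w \<noteq> v"
        and c: "lex_product n f g {v, w} = c"
        by (auto simp: N_def)
      show "p \<in> ?P"
        using c div_mod_lessThan_mult[OF w(1)] mod_neq_if_div_eq[OF w(2), of n]
        by (cases "w div n = v div n") (auto simp: p A_def B_def lex_product_pair)
    qed
    have "q * n + r < m * n" if "q < m" "r < n" for q r
    proof -
      have "q * n + r < Suc q * n" using that by simp
      also have "\<dots> \<le> m * n" using that by (intro mult_le_mono1) simp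
      finally show ?thesis .
    qed
    moreover have "v div n < m" using assms by (rule div_mod_lessThan_mult)
    moreover have "v div n * n + r \<noteq> v" if "r \<noteq> v mod n" for r
      using that by (metis add_left_cancel div_mult_mod_eq)
    ultimately show "(\<lambda>(q, r). q * n + r) ` ?P \<subseteq> N"
      by (auto simp: N_def A_def B_def lex_product_pair)
  qed
  then have "card N = card ?P"
    by (rule bij_betw_same_card)
  \<comment> \<open>The two parts are disjoint because \<open>A\<close> excludes the block of
    \<open>v\<close>.\<close>
  also have "\<dots> = card A * n + card B"
    by (subst card_Un_disjoint) (auto simp: A_def B_def card_cartesian_product)
  finally show ?thesis
    using assms div_mod_lessThan_mult[OF assms]
    by (simp add: color_degree_eq_card_neighbours N_def A_def B_def)
qed

lemma balanced_lex_product: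
  assumes "balanced {..<m} C f" "balanced {..<n} C g"
  shows "balanced {..<m * n} C (lex_product n f g)"
proof -
  obtain d d' where "\<forall>v\<in>{..<m}. \<forall>c\<in>C. color_degree {..<m} f v c = d"
    and "\<forall>v\<in>{..<n}. \<forall>c\<in>C. color_degree {..<n} g v c = d'"
    using assms by (auto simp: balanced_def)
  then have "\<forall>v\<in>{..<m * n}. \<forall>c\<in>C. color_degree {..<m * n} (lex_product n f g) v c = d * n + d'"
    by (simp add: color_degree_lex_product div_mod_lessThan_mult)
  then show ?thesis
    unfolding balanced_def by blast
qed

lemma has_rainbow_complete_image:
  assumes S: "S \<in> [V]\<^bsup>k\<^esup>" and h: "inj_on h ([S]\<^bsup>2\<^esup>)"
    and p: "inj_on p S" "p \<in> S \<rightarrow> W"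
    and hf: "\<And>x y. x \<in> S \<Longrightarrow> y \<in> S \<Longrightarrow> x \<noteq> y \<Longrightarrow> h {x, y} = f {p x, p y}"
  shows "has_rainbow_complete k W f"
proof -
  have "p ` S \<in> [W]\<^bsup>k\<^esup>"
    using S p by (auto simp: nsets_def card_image)
  moreover have "inj_on f ([p ` S]\<^bsup>2\<^esup>)"
  proof (rule inj_onI)
    have pair: "\<exists>x\<in>S. \<exists>y\<in>S. x \<noteq> y \<and> e = {p x, p y}" if "e \<in> [p ` S]\<^bsup>2\<^esup>" for e
      using that by (auto simp: nsets_2_eq) metis
    fix a b assume "a \<in> [p ` S]\<^bsup>2\<^esup>" "b \<in> [p ` S]\<^bsup>2\<^esup>" and eq: "f a = f b"
    then obtain x y z w where xy: "x \<in> S" "y \<in> S" "x \<noteq> y" "a = {p x, p y}"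
      and zw: "z \<in> S" "w \<in> S" "z \<noteq> w" "b = {p z, p w}"
      using pair[of a] pair[of b] by blast
    then have "h {x, y} = h {z, w}"
      using eq hf by simp
    moreover have "{x, y} \<in> [S]\<^bsup>2\<^esup>" "{z, w} \<in> [S]\<^bsup>2\<^esup>"
      using xy zw by (auto simp: nsets_2_eq)
    ultimately have "{x, y} = {z, w}"
      using h by (auto dest: inj_onD)
    then show "a = b"
      using xy zw by (auto simp: doubleton_eq_iff)
  qed
  ultimately show ?thesis
    unfolding has_rainbow_complete_def by blast
qed

lemma has_rainbow_complete_lex_product:
  assumes "has_rainbow_complete k {..<m * n} (lex_product n f g)"
  shows "has_rainbow_complete k {..<m} f \<or> has_rainbow_complete k {..<n} g"
proof -
  let ?h = "lex_product n f g"
  obtain S where S: "S \<in> [{..<m * n}]\<^bsup>k\<^esup>" and inj: "inj_on ?h ([S]\<^bsup>2\<^esup>)"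
    using assms by (auto simp: has_rainbow_complete_def)
  then have lt: "x < m * n" if "x \<in> S" for x
    using that by (auto simp: nsets_def)
  \<comment> \<open>If two vertices share a block, then either all of \<open>S\<close> lies in that
    block or some \<open>z\<close> lies outside of it.\<close>
  consider (outer) "inj_on (\<lambda>x. x div n) S"
    | (inner) "\<forall>x\<in>S. \<forall>y\<in>S. x div n = y div n"
    | (mixed) x y z where "x \<in> S" "y \<in> S" "z \<in> S" "x \<noteq> y" "x div n = y div n" "z div n \<noteq> x div n"
    by (metis inj_onI)
  then show ?thesis
  proof cases
    case outer
    then have "has_rainbow_complete k {..<m} f"
      using lt by (intro has_rainbow_complete_image[OF S inj outer])
        (auto simp: div_mod_lessThan_mult lex_product_pair inj_on_def)
    then show ?thesis ..
  next
    case inner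
    have "inj_on (\<lambda>x. x mod n) S"
      using inner mod_neq_if_div_eq by (meson inj_onI)
    then have "has_rainbow_complete k {..<n} g"
    proof (rule has_rainbow_complete_image[OF S inj])
      show "(\<lambda>x. x mod n) \<in> S \<rightarrow> {..<n}"
        using lt div_mod_lessThan_mult(2) by blast
      show "?h {x, y} = g {x mod n, y mod n}" if "x \<in> S" "y \<in> S" for x y
        using inner[rule_format, OF that] by (simp add: lex_product_pair)
    qed
    then show ?thesis ..
  next
    case mixed
    have "?h {x, z} = ?h {y, z}"
      using mixed by (simp add: lex_product_pair)
    moreover have "{x, z} \<in> [S]\<^bsup>2\<^esup>" "{y, z} \<in> [S]\<^bsup>2\<^esup>"
      using mixed by (auto simp: nsets_2_eq)
    ultimately have "{x, z} = {y, z}"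
      using inj by (auto dest: inj_onD)
    then show ?thesis
      using mixed by (auto simp: doubleton_eq_iff)
  qed
qed

section \<open>A coloring on thirteen vertices\<close>

text \<open>Found by simulated annealing among the colorings that are equivariant under an automorphism
  of order \<open>3\<close>: it fixes the vertex \<open>12\<close>, and it permutes cyclically the vertices of each block
  \<open>{3i, 3i + 1, 3i + 2}\<close> and the colors of each of the blocks \<open>{0, 1, 2}\<close> and \<open>{3, 4, 5}\<close>.
  The diagonal entries are never used.\<close>

definition color_table :: "nat list list" where
  "color_table =
    [[0, 4, 3, 0, 3, 2, 1, 2, 1, 5, 5, 0, 4],
     [4, 0, 5, 0, 1, 4, 2, 2, 0, 1, 3, 3, 5],
     [3, 5, 0, 5, 1, 2, 1, 0, 0, 4, 2, 4, 3],
     [0, 0, 5, 0, 2, 1, 5, 1, 4, 3, 4, 3, 2],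
     [3, 1, 1, 2, 0, 0, 5, 3, 2, 4, 4, 5, 0],
     [2, 4, 2, 1, 0, 0, 0, 3, 4, 3, 5, 5, 1],
     [1, 2, 1, 5, 5, 0, 0, 4, 3, 0, 3, 2, 4],
     [2, 2, 0, 1, 3, 3, 4, 0, 5, 0, 1, 4, 5],
     [1, 0, 0, 4, 2, 4, 3, 5, 0, 5, 1, 2, 3],
     [5, 1, 4, 3, 4, 3, 0, 0, 5, 0, 2, 1, 2],
     [5, 3, 2, 4, 4, 5, 3, 1, 1, 2, 0, 0, 0],
     [0, 3, 4, 3, 5, 5, 2, 4, 2, 1, 0, 0, 1],
     [4, 5, 3, 2, 0, 1, 4, 5, 3, 2, 0, 1, 0]]"

text \<open>\<open>Min\<close> and \<open>Max\<close> recover the endpoints from the unordered edge;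
  the symmetry of the table makes their order irrelevant.\<close>

definition color13 :: "nat set \<Rightarrow> nat" where
  "color13 e = color_table ! Min e ! Max e"

lemma color_table_symmetric:
  "\<forall>i\<in>set [0..<13]. \<forall>j\<in>set [0..<13]. color_table ! i ! j = color_table ! j ! i"
  by code_simp

lemma color_table_less:
  "\<forall>i\<in>set [0..<13]. \<forall>j\<in>set [0..<13]. color_table ! i ! j < 6"
  by code_simp

text \<open>The 12 edges at a vertex split evenly among 6 colors. The condition
  \<open>j \<noteq> i\<close> keeps the diagonal entry from counting as color 0.\<close>

lemma color_table_degree:
  "\<forall>i\<in>set [0..<13]. \<forall>c\<in>set [0..<6].
     length (filter (\<lambda>j. j \<noteq> i \<and> color_table ! i ! j = c) [0..<13]) = 2"
  by code_simp

text \<open>With \<open>a < b < c < d\<close>, each of the 715 four-element sets is evaluated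
  exactly once.\<close>

lemma color_table_no_rainbow:
  "\<forall>d\<in>set [0..<13]. \<forall>c\<in>set [0..<d]. \<forall>b\<in>set [0..<c]. \<forall>a\<in>set [0..<b].
     \<not> distinct [color_table ! a ! b, color_table ! a ! c, color_table ! a ! d,
                 color_table ! b ! c, color_table ! b ! d, color_table ! c ! d]"
  by code_simp

lemma color13_pair:
  assumes "i < 13" "j < 13"
  shows "color13 {i, j} = color_table ! i ! j"
  using color_table_symmetric assms by (simp add: color13_def min_def max_def)

lemma edge_coloring_color13: "edge_coloring {..<13} {..<6} color13"
  using color_table_less by (auto simp: edge_coloring_def nsets_2_eq color13_pair)

lemma balanced_color13: "balanced {..<13} {..<6} color13"
proof -
  have "color_degree {..<13} color13 v c = 2" if "v < 13" "c < 6" for v c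
  proof -
    have "color_degree {..<13} color13 v c = card {w \<in> {..<13}. w \<noteq> v \<and> color13 {v, w} = c}"
      using that by (simp add: color_degree_eq_card_neighbours)
    also have "{w \<in> {..<13}. w \<noteq> v \<and> color13 {v, w} = c} =
        set (filter (\<lambda>j. j \<noteq> v \<and> color_table ! v ! j = c) [0..<13])"
      using that by (auto simp: color13_pair)
    also have "card \<dots> = 2"
      using color_table_degree that by (subst distinct_card) auto
    finally show ?thesis .
  qed
  then show ?thesis
    by (auto simp: balanced_def)
qed

lemma no_rainbow_color13: "\<not> has_rainbow_complete 4 {..<13} color13"
proof
  assume "has_rainbow_complete 4 {..<13} color13"
  then obtain S where S: "S \<subseteq> {..<13}" "finite S" "card S = 4" and inj: "inj_on color13 ([S]\<^bsup>2\<^esup>)"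
    by (auto simp: has_rainbow_complete_def nsets_def)
  \<comment> \<open>Sorting \<open>S\<close> yields its vertices in the increasing order in which
    the table was checked.\<close>
  have "length (sorted_list_of_set S) = 4"
    using S by simp
  then obtain a b c d where l: "sorted_list_of_set S = [a, b, c, d]"
    by (auto simp: numeral_eq_Suc length_Suc_conv simp del: length_sorted_list_of_set)
  have S_eq: "S = {a, b, c, d}"
    using set_sorted_list_of_set[OF S(2)] l by simp
  have less: "a < b" "b < c" "c < d"
    using strict_sorted_list_of_set[of S] l by auto
  have "d < 13"
    using S(1) S_eq by auto
  let ?es = "[{a, b}, {a, c}, {a, d}, {b, c}, {b, d}, {c, d}]"
  have neq: "a \<noteq> b" "a \<noteq> c" "a \<noteq> d" "b \<noteq> c" "b \<noteq> d" "c \<noteq> d"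
    using less by auto
  then have "distinct ?es"
    by (simp add: doubleton_eq_iff)
  moreover have "set ?es \<subseteq> [S]\<^bsup>2\<^esup>"
    using neq by (simp add: S_eq)
  ultimately have "distinct (map color13 ?es)"
    using inj inj_on_subset unfolding distinct_map by blast
  then show False
    using color_table_no_rainbow[rule_format, of d c b a] less \<open>d < 13\<close>
    by (simp add: color13_pair)
qed

theorem theorem1:
  fixes k :: nat
  assumes "k \<ge> 1"
  shows "\<exists>f :: nat set \<Rightarrow> nat.
    edge_coloring {..<13 ^ k} {..<6} f \<and>
    balanced {..<13 ^ k} {..<6} f \<and>
    \<not> has_rainbow_complete 4 {..<13 ^ k} f"
  using assms
proof (induction k rule: dec_induct)
  case base
  show ?case
    using edge_coloring_color13 balanced_color13 no_rainbow_color13 by auto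
next
  case (step k)
  then obtain f :: "nat set \<Rightarrow> nat" where "edge_coloring {..<13 ^ k} {..<6} f" "balanced {..<13 ^ k} {..<6} f"
    "\<not> has_rainbow_complete 4 {..<13 ^ k} f"
    by blast
  \<comment> \<open>The outer factor is \<open>color13\<close>: 13 blocks of size
    \<open>13 ^ k\<close> match \<open>13 ^ Suc k = 13 * 13 ^ k\<close>.\<close>
  then show ?case
    using edge_coloring_color13 balanced_color13 no_rainbow_color13 unfolding power_Suc
    by (intro exI[of _ "lex_product (13 ^ k) color13 f"])
      (auto intro: edge_coloring_lex_product balanced_lex_product
        dest: has_rainbow_complete_lex_product)
qed

end
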